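(* Let $A,C,\sigma$ be positive real numbers and consider the system $$\dot x=Ayz+Cz-\sigma x,\qquad \dot y=-xz+R_a-y,\qquad \dot z=-z+xy$$ on $\mathbb{R}^3$ with parameter $R_a>0$. Let $L(A,\sigma,C)$, $R_a^{**}$ and $E_+$ be as defined in the context. Assume $L(A,\sigma,C)>0$ and $R_a=R_a^{**}$. Then the system undergoes a Hopf bifurcation at $E_+$.
   Context: For $R_a>R_a^*:=\frac{\sqrt{C^2+4A\sigma}-C}{2A}$ the system has the equilibrium $$E_{+}=\left(\sqrt{\eta},\frac{R_a}{\eta+1},\frac{R_a\sqrt{\eta}}{\eta+1}\right),\qquad \eta=\frac{CR_a-2\sigma+R_a\sqrt{C^2+4A\sigma}}{2\sigma}.$$ Define $$\begin{aligned}L(A,\sigma,C)={}&-AC\sigma^3+3AC\sigma^2+C^3\sigma-6AC\sigma-2C^3\\&+\sqrt{4A\sigma+C^2}\,(-A\sigma^3+A\sigma^2+C^2\sigma-2A\sigma-2C^2),\\ R(A,\sigma,C)={}&C^2\sigma^3+8A\sigma^3+4C^2\sigma^2+\sqrt{4A\sigma+C^2}\,(C\sigma^3+4C\sigma^2),\end{aligned}$$ and, when $L(A,\sigma,C)>0$, $R_a^{**}=R(A,\sigma,C)/L(A,\sigma,C)$. The bifurcation parameter is $R_a$, with $A,\sigma,C$ fixed. A Hopf bifurcation at $E_+$ at $R_a=R_a^{**}$ means: at $R_a=R_a^{**}$ the linearization at $E_+$ has a simple pair of purely imaginary eigenvalues $\pm iw_0$ ($w_0>0$) and no other eigenvalue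 on the imaginary axis, and the transversality condition holds, i.e. the real part of the continuation of this pair of eigenvalues has nonzero derivative with respect to $R_a$ at $R_a=R_a^{**}$. *)

theory Defs
  imports "HOL-Analysis.Analysis" "HOL-Computational_Algebra.Polynomial"
begin

definition complex_matrix :: "real^'n^'m \<Rightarrow> complex^'n^'m" where
  "complex_matrix M = (\<chi> i j. complex_of_real (M $ i $ j))"

definition char_polynomial :: "'a::comm_ring_1^'n^'n \<Rightarrow> 'a poly" where
  "char_polynomial M = det (mat [:0, 1:] - (\<chi> i j. [:M $ i $ j:]))"

definition is_eigenvalue :: "'a::field^'n^'n \<Rightarrow> 'a \<Rightarrow> bool" where
  "is_eigenvalue M l \<longleftrightarrow> (\<exists>v. v \<noteq> 0 \<and> M *v v = l *s v)"

definition simple_eigenvalue :: "'a::field^'n^'n \<Rightarrow> 'a \<Rightarrow> bool" where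
  "simple_eigenvalue M l \<longleftrightarrow> is_eigenvalue M l \<and> order l (char_polynomial M) = 1"

definition linearization ::
    "(real \<Rightarrow> real^'n \<Rightarrow> real^'n) \<Rightarrow> (real \<Rightarrow> real^'n) \<Rightarrow> real \<Rightarrow> complex^'n^'n" where
  "linearization f E r = complex_matrix (jacobian (f r) (at (E r)))"

text \<open>
  Hopf bifurcation of \<open>x' = f r x\<close> along the branch of equilibria \<open>E\<close> at the parameter value
  \<open>r0\<close>. The function \<open>ev\<close> is the continuation of the eigenvalue \<open>\<i> w0\<close>: as that eigenvalue is
  simple, a continuous branch through it is unique near \<open>r0\<close>. The Jacobian being real, the
  continuation of \<open>-\<i> w0\<close> is the conjugate branch, with the same real part.
\<close>

definition hopf_bifurcation ::
    "(real \<Rightarrow> real^'n \<Rightarrow> real^'n) \<Rightarrow> (real \<Rightarrow> real^'n) \<Rightarrow> real \<Rightarrow> bool" where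
  "hopf_bifurcation f E r0 \<longleftrightarrow>
    (\<exists>\<epsilon>>0. \<exists>w0>0. \<exists>ev :: real \<Rightarrow> complex.
      (\<forall>r\<in>{r0 - \<epsilon><..<r0 + \<epsilon>}. f r (E r) = 0 \<and> f r differentiable (at (E r))) \<and>
      simple_eigenvalue (linearization f E r0) (\<i> * complex_of_real w0) \<and>
      simple_eigenvalue (linearization f E r0) (- \<i> * complex_of_real w0) \<and>
      (\<forall>l. is_eigenvalue (linearization f E r0) l \<and> Re l = 0 \<longrightarrow>
            l = \<i> * complex_of_real w0 \<or> l = - \<i> * complex_of_real w0) \<and>
      ev r0 = \<i> * complex_of_real w0 \<and>
      continuous_on {r0 - \<epsilon><..<r0 + \<epsilon>} ev \<and>
      (\<forall>r\<in>{r0 - \<epsilon><..<r0 + \<epsilon>}. is_eigenvalue (linearization f E r) (ev r)) \<and>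
      (\<exists>d. d \<noteq> 0 \<and> ((\<lambda>r. Re (ev r)) has_real_derivative d) (at r0)))"

definition vector_field :: "real \<Rightarrow> real \<Rightarrow> real \<Rightarrow> real \<Rightarrow> real^3 \<Rightarrow> real^3" where
  "vector_field A \<sigma> C Ra p =
    vector [A * p $ 2 * p $ 3 + C * p $ 3 - \<sigma> * p $ 1,
            - p $ 1 * p $ 3 + Ra - p $ 2,
            - p $ 3 + p $ 1 * p $ 2]"

definition eta :: "real \<Rightarrow> real \<Rightarrow> real \<Rightarrow> real \<Rightarrow> real" where
  "eta A \<sigma> C Ra = (C * Ra - 2 * \<sigma> + Ra * sqrt (C^2 + 4 * A * \<sigma>)) / (2 * \<sigma>)"

text \<open>
  The equilibrium exists for \<open>Ra > (sqrt (C^2 + 4 * A * \<sigma>) - C) / (2 * A)\<close>, which for positive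
  \<open>A\<close>, \<open>\<sigma>\<close>, \<open>C\<close> is equivalent to \<open>eta A \<sigma> C Ra > 0\<close>. Below that threshold \<open>sqrt\<close> takes the value
  \<open>- sqrt (- eta)\<close> and \<open>E_plus\<close> is not an equilibrium, so the equilibrium condition in
  \<open>hopf_bifurcation\<close> fails there.
\<close>

definition E_plus :: "real \<Rightarrow> real \<Rightarrow> real \<Rightarrow> real \<Rightarrow> real^3" where
  "E_plus A \<sigma> C Ra =
    vector [sqrt (eta A \<sigma> C Ra),
            Ra / (eta A \<sigma> C Ra + 1),
            Ra * sqrt (eta A \<sigma> C Ra) / (eta A \<sigma> C Ra + 1)]"

definition L_fun :: "real \<Rightarrow> real \<Rightarrow> real \<Rightarrow> real" where
  "L_fun A \<sigma> C =
    - A * C * \<sigma>^3 + 3 * A * C * \<sigma>^2 + C^3 * \<sigma> - 6 * A * C * \<sigma> - 2 * C^3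
    + sqrt (4 * A * \<sigma> + C^2) * (- A * \<sigma>^3 + A * \<sigma>^2 + C^2 * \<sigma> - 2 * A * \<sigma> - 2 * C^2)"

definition R_fun :: "real \<Rightarrow> real \<Rightarrow> real \<Rightarrow> real" where
  "R_fun A \<sigma> C =
    C^2 * \<sigma>^3 + 8 * A * \<sigma>^3 + 4 * C^2 * \<sigma>^2
    + sqrt (4 * A * \<sigma> + C^2) * (C * \<sigma>^3 + 4 * C * \<sigma>^2)"

definition Ra_Hopf :: "real \<Rightarrow> real \<Rightarrow> real \<Rightarrow> real" where
  "Ra_Hopf A \<sigma> C = R_fun A \<sigma> C / L_fun A \<sigma> C"

end

theory Submission
  imports Defs
begin

text \<open>
  With \<open>k = (C + sqrt (C^2 + 4 * A * \<sigma>)) / (2 * \<sigma>)\<close> and \<open>b = A / k^2\<close> the square root disappears: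
  \<open>A = k^2 * b\<close>, \<open>C = k * (\<sigma> - b)\<close>, \<open>\<eta> = k * Ra - 1\<close>, and the characteristic polynomial at the
  equilibrium is
  \<open>X^3 + (\<sigma> + 2) * X^2 + (\<sigma> + 1 + (1 + b) * \<eta>) * X + 2 * (\<sigma> + b) * \<eta>\<close>.
  Its quadratic coefficient is constant, so a pair of roots \<open>u \<plusminus> \<i> v\<close> forces the third root to be
  \<open>- (\<sigma> + 2) - 2 * u\<close>. Eliminating \<open>v\<close> from the other two coefficients expresses \<open>\<eta>\<close> as a rational
  function of \<open>u\<close>, strictly increasing near \<open>u = 0\<close>. Its local inverse is the real part of the
  eigenvalue branch, so transversality holds. The value \<open>u = 0\<close> corresponds to \<open>Ra_Hopf\<close>, where the
  positivity of \<open>L_fun\<close> is that of the denominator \<open>\<sigma> - 2 - b * \<sigma>\<close> of the rational function.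
\<close>

section \<open>Characteristic polynomial and eigenvalues\<close>

lemma poly_char_polynomial: "poly (char_polynomial M) l = det (mat l - M)"
proof -
  \<comment> \<open>Evaluation at \<open>l\<close> is a ring homomorphism, so it passes through the
    Leibniz sum once its effect on signs and entries is known.\<close>
  have sgn: "poly (of_int (sign p)) l = of_int (sign p)" for p :: "'b \<Rightarrow> 'b"
    by (simp add: sign_def)
  have ent: "poly ((mat [:0, 1:] - (\<chi> i j. [:M $ i $ j:])) $ i $ j) l = (mat l - M) $ i $ j" for i j
    by (simp add: mat_def)
  show ?thesis
    unfolding char_polynomial_def det_def poly_sum poly_mult poly_prod sgn ent ..
qed

lemma is_eigenvalue_iff_root: "is_eigenvalue M l \<longleftrightarrow> poly (char_polynomial M) l = 0"
  for M :: "'a::field^'n^'n"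
proof -
  have mv: "(mat l - M) *v v = l *s v - M *v v" for v
  proof -
    have "mat l *v v = l *s v"
      by (simp add: mat_def matrix_vector_mult_def vec_eq_iff if_distrib [of "\<lambda>x. x * _"]
          cong: if_cong)
    then show ?thesis by (simp add: matrix_vector_mult_diff_rdistrib)
  qed
  have "det (mat l - M) \<noteq> 0 \<longleftrightarrow> (\<forall>v. (mat l - M) *v v = 0 \<longrightarrow> v = 0)"
    by (metis invertible_det_nz invertible_left_inverse matrix_left_invertible_ker)
  then show ?thesis
    unfolding poly_char_polynomial is_eigenvalue_def mv by auto
qed

lemma char_polynomial_3:
  "char_polynomial M = [:- det M,
     M $ 1 $ 1 * M $ 2 $ 2 - M $ 1 $ 2 * M $ 2 $ 1 + (M $ 1 $ 1 * M $ 3 $ 3 - M $ 1 $ 3 * M $ 3 $ 1)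
       + (M $ 2 $ 2 * M $ 3 $ 3 - M $ 2 $ 3 * M $ 3 $ 2),
     - (M $ 1 $ 1 + M $ 2 $ 2 + M $ 3 $ 3), 1:]"
  for M :: "'a::comm_ring_1^3^3"
  unfolding char_polynomial_def det_3
  by (simp add: mat_def algebra_simps)

section \<open>Jacobian of the vector field\<close>

lemma vector_field_has_derivative:
  "(vector_field A \<sigma> C r has_derivative
     (*v) (vector [vector [- \<sigma>, A * p $ 3, A * p $ 2 + C],
                   vector [- p $ 3, - 1, - p $ 1],
                   vector [p $ 2, p $ 1, - 1]] :: real^3^3)) (at p)"
proof -
  \<comment> \<open>Splitting along the axes reduces the derivative of the vector to those of its
    scalar components.\<close>
  have vec: "(vector [a, b, c] :: real^3) = a *\<^sub>R axis 1 1 + b *\<^sub>R axis 2 1 + c *\<^sub>R axis 3 1"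
    for a b c
    by (simp add: vec_eq_iff forall_3 axis_def)
  have nth: "((\<lambda>x :: real^3. x $ i) has_derivative (\<lambda>h. h $ i)) (at p)" for i
    by (rule bounded_linear.has_derivative [OF bounded_linear_vec_nth has_derivative_ident])
  show ?thesis
    unfolding vector_field_def [abs_def] vec
    apply (rule has_derivative_eq_rhs)
     apply (rule derivative_eq_intros nth refl)+
    apply (rule ext)
    apply (simp add: vec_eq_iff forall_3 axis_def matrix_vector_mult_def sum_3 algebra_simps)
    done
qed

lemma jacobian_vector_field:
  "jacobian (vector_field A \<sigma> C r) (at p) =
     vector [vector [- \<sigma>, A * p $ 3, A * p $ 2 + C],
             vector [- p $ 3, - 1, - p $ 1],
             vector [p $ 2, p $ 1, - 1]]"
  unfolding jacobian_def
  using frechet_derivative_at [OF vector_field_has_derivative [of A \<sigma> C r p]]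
  by (metis matrix_of_matrix_vector_mul)

section \<open>Removal of the square root\<close>

text \<open>\<open>k\<close> is the positive root of \<open>\<sigma> * k^2 = A + C * k\<close>, the
  equation satisfied by \<open>1 / y\<close> at an equilibrium with \<open>x \<noteq> 0\<close>.
  Thus \<open>E_plus\<close> has second coordinate \<open>1 / k\<close>, whatever the
  parameter.\<close>

lemma reparametrization:
  fixes A \<sigma> C :: real
  assumes "A > 0" "C > 0" "\<sigma> > 0"
  obtains k b where "k > 0" "0 < b" "A = k^2 * b" "C = k * (\<sigma> - b)"
proof -
  define S where "S = sqrt (C^2 + 4 * A * \<sigma>)"
  define k where "k = (C + S) / (2 * \<sigma>)"
  have S2: "S^2 = C^2 + 4 * A * \<sigma>" and "S > 0"
    using assms by (simp_all add: S_def add_pos_pos)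
  have k: "k > 0" using assms \<open>S > 0\<close> by (simp add: k_def)
  have S: "S = 2 * \<sigma> * k - C" using assms by (simp add: k_def)
  have "4 * \<sigma> * (\<sigma> * k^2 - C * k) = 4 * \<sigma> * A"
    using S2 unfolding S by (simp add: power2_eq_square algebra_simps)
  then have A: "A = \<sigma> * k^2 - C * k" using assms by simp
  show thesis
  proof
    show "0 < A / k^2" "A = k^2 * (A / k^2)" using k assms by simp_all
    show "C = k * (\<sigma> - A / k^2)" using k by (simp add: A field_simps power2_eq_square)
  qed (fact k)
qed

lemma sqrt_discriminant:
  fixes k b \<sigma> :: real
  assumes "k > 0" "0 < b" "0 < \<sigma>"
  shows "sqrt ((k * (\<sigma> - b))^2 + 4 * (k^2 * b) * \<sigma>) = k * (\<sigma> + b)"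
proof -
  have "(k * (\<sigma> - b))^2 + 4 * (k^2 * b) * \<sigma> = (k * (\<sigma> + b))^2"
    by (simp add: power2_eq_square algebra_simps)
  then show ?thesis using assms by simp
qed

lemma eta_reparametrized:
  fixes k b \<sigma> :: real
  assumes "k > 0" "0 < b" "0 < \<sigma>"
  shows "eta (k^2 * b) \<sigma> (k * (\<sigma> - b)) r = k * r - 1"
  unfolding eta_def sqrt_discriminant [OF assms]
  using assms by (simp add: field_simps)

text \<open>The square root and \<open>C\<close> add up to \<open>2 * \<sigma> * k\<close>, which
  leaves a polynomial that factors.\<close>

lemma R_fun_reparametrized:
  fixes k b \<sigma> :: real
  assumes "k > 0" "0 < b" "0 < \<sigma>"
  shows "R_fun (k^2 * b) \<sigma> (k * (\<sigma> - b)) = 2 * \<sigma>^4 * k^2 * (\<sigma> + 4 - b)"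
proof -
  have "sqrt (4 * (k^2 * b) * \<sigma> + (k * (\<sigma> - b))^2) = k * (\<sigma> + b)"
    using sqrt_discriminant [OF assms] by (simp add: add.commute)
  then show ?thesis
    unfolding R_fun_def by algebra
qed

lemma L_fun_reparametrized:
  fixes k b \<sigma> :: real
  assumes "k > 0" "0 < b" "0 < \<sigma>"
  shows "L_fun (k^2 * b) \<sigma> (k * (\<sigma> - b)) = 2 * \<sigma>^3 * k^3 * (\<sigma> - 2 - b * \<sigma>)"
proof -
  have "sqrt (4 * (k^2 * b) * \<sigma> + (k * (\<sigma> - b))^2) = k * (\<sigma> + b)"
    using sqrt_discriminant [OF assms] by (simp add: add.commute)
  then show ?thesis
    unfolding L_fun_def by algebra
qed

section \<open>The equilibrium and its linearization\<close>

lemma E_plus_equilibrium: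
  fixes k b \<sigma> :: real
  assumes "k > 0" "0 < b" "0 < \<sigma>" "k * r - 1 > 0"
  shows "vector_field (k^2 * b) \<sigma> (k * (\<sigma> - b)) r (E_plus (k^2 * b) \<sigma> (k * (\<sigma> - b)) r) = 0"
proof -
  \<comment> \<open>The denominator \<open>\<eta> + 1\<close> in \<open>E_plus\<close> is
    \<open>k * r\<close>, so \<open>r\<close> has to be cancelled.\<close>
  have "r \<noteq> 0" using assms by auto
  moreover have "sqrt (k * r - 1) * sqrt (k * r - 1) = k * r - 1" using assms by simp
  ultimately show ?thesis
    unfolding vector_field_def E_plus_def eta_reparametrized [OF assms(1-3)]
    using assms(1) by (simp add: vec_eq_iff forall_3 power2_eq_square field_simps)
qed

lemma char_polynomial_linearization:
  fixes k b \<sigma> :: real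
  assumes "k > 0" "0 < b" "0 < \<sigma>" "k * r - 1 > 0"
  shows "char_polynomial (linearization (vector_field (k^2 * b) \<sigma> (k * (\<sigma> - b)))
            (E_plus (k^2 * b) \<sigma> (k * (\<sigma> - b))) r) =
         map_poly complex_of_real
           [:2 * (\<sigma> + b) * (k * r - 1), \<sigma> + 1 + (1 + b) * (k * r - 1), \<sigma> + 2, 1:]"
proof -
  define s where "s = sqrt (k * r - 1)"
  have "s * s = k * r - 1" using assms by (simp add: s_def)
  \<comment> \<open>Expressing \<open>r\<close> through \<open>s\<close> makes all coordinates
    rational in \<open>s\<close> and \<open>k\<close>.\<close>
  then have r: "r = (s * s + 1) / k" using assms by (simp add: field_simps)
  have "s * s + 1 > 0" by (simp add: add_nonneg_pos)
  have E: "E_plus (k^2 * b) \<sigma> (k * (\<sigma> - b)) r = vector [s, 1 / k, s / k]"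
    unfolding E_plus_def eta_reparametrized [OF assms(1-3)]
    unfolding s_def [symmetric] unfolding r
    using assms(1) \<open>s * s + 1 > 0\<close> by (simp add: mult.commute)
  \<comment> \<open>The entry \<open>\<sigma> * k\<close> is \<open>A * y + C\<close> with
    \<open>y = 1 / k\<close>, that is \<open>k * b + k * (\<sigma> - b)\<close>.\<close>
  have J: "jacobian (vector_field (k^2 * b) \<sigma> (k * (\<sigma> - b)) r)
        (at (E_plus (k^2 * b) \<sigma> (k * (\<sigma> - b)) r)) =
      vector [vector [- \<sigma>, k * b * s, \<sigma> * k],
              vector [- (s / k), - 1, - s],
              vector [1 / k, s, - 1]]"
    unfolding jacobian_vector_field E using assms(1)
    by (simp add: power2_eq_square vec_eq_iff forall_3 field_simps)
  show ?thesis
    unfolding linearization_def J char_polynomial_3 det_3 complex_matrix_def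
    using assms(1) by (simp add: map_poly_pCons r field_simps)
qed

section \<open>Auxiliary facts on cubics and local inverses\<close>

text \<open>The cubic is the expansion of
  \<open>(X^2 - 2 * u * X + u^2 + v^2) * (X + \<alpha> + 2 * u)\<close>.\<close>

lemma root_of_factored_cubic:
  fixes \<alpha> u v :: real
  shows "poly (map_poly complex_of_real
      [:(u\<^sup>2 + v\<^sup>2) * (\<alpha> + 2 * u), u\<^sup>2 + v\<^sup>2 - 2 * u * (\<alpha> + 2 * u), \<alpha>, 1:]) (Complex u v) = 0"
  by (simp add: map_poly_pCons complex_eq_iff power2_eq_square algebra_simps)

lemma simple_root_order:
  fixes l :: "'a::field"
  assumes "p = [:- l, 1:] * q" "poly q l \<noteq> 0"
  shows "order l p = 1"
proof -
  have "q \<noteq> 0" using assms by auto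
  then have "p \<noteq> 0" unfolding assms by (metis mult_eq_0_iff pCons_eq_0_iff one_neq_zero)
  moreover have "order l [:- l, 1:] = 1"
    using order_power_n_n [of l 1] by simp
  ultimately show ?thesis
    using assms order_mult [of "[:- l, 1:]" q l] by (simp add: order_0I)
qed

text \<open>Invariance of domain in dimension one; it yields a continuous inverse from injectivity
  alone, without derivatives on the whole of \<open>S\<close>.\<close>

lemma continuous_inj_real_inverse:
  fixes f :: "real \<Rightarrow> real"
  assumes "open S" "continuous_on S f" "inj_on f S"
  shows "open (f ` S)" "continuous_on (f ` S) (inv_into S f)"
proof -
  show "open (f ` S)" using assms by (intro invariance_of_domain)
  show "continuous_on (f ` S) (inv_into S f)"
    using assms by (intro continuous_on_inverse_open) auto
qed

lemma purely_imaginary_pair: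
  fixes \<alpha> w :: real
  assumes "\<alpha> > 0" "w > 0"
  defines "p \<equiv> map_poly complex_of_real [:w\<^sup>2 * \<alpha>, w\<^sup>2, \<alpha>, 1:]"
  shows "order (\<i> * w) p = 1" "order (- \<i> * w) p = 1"
    and "poly p l = 0 \<Longrightarrow> Re l = 0 \<Longrightarrow> l = \<i> * w \<or> l = - \<i> * w"
proof -
  \<comment> \<open>The equation \<open>l * l = - (w * w)\<close> covers both signs at once:
    \<open>p\<close> is \<open>(X - l) * (X + l) * (X + \<alpha>)\<close>, and the last two factors
    form the cofactor.\<close>
  have "order l p = 1" if l: "l * l = - (w * w)" for l :: complex
  proof (rule simple_root_order)
    have "complex_of_real w ^ 2 = - (l * l)" using l by (simp add: power2_eq_square)
    then show "p = [:- l, 1:] * [:l * \<alpha>, l + \<alpha>, 1:]"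
      by (simp add: p_def map_poly_pCons algebra_simps)
    have "l \<noteq> 0" using l assms by auto
    moreover have "l + \<alpha> \<noteq> 0"
    proof
      assume "l + \<alpha> = 0"
      then have "l = - of_real \<alpha>" by (simp add: eq_neg_iff_add_eq_0)
      with l have "complex_of_real (\<alpha> * \<alpha> + w * w) = 0" by simp
      then have "\<alpha> * \<alpha> + w * w = 0" by (simp only: of_real_eq_0_iff)
      with assms show False by (simp add: add_pos_pos)
    qed
    moreover have "poly [:l * \<alpha>, l + \<alpha>, 1:] l = 2 * l * (l + \<alpha>)"
      by (simp add: algebra_simps)
    ultimately show "poly [:l * \<alpha>, l + \<alpha>, 1:] l \<noteq> 0" by simp
  qed
  then show "order (\<i> * w) p = 1" "order (- \<i> * w) p = 1"
    by (simp_all add: algebra_simps)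
  assume "poly p l = 0" "Re l = 0"
  moreover have "poly p l = (l - \<i> * w) * (l + \<i> * w) * (l + \<alpha>)"
    by (simp add: p_def map_poly_pCons power2_eq_square algebra_simps)
  moreover have "l + \<alpha> \<noteq> 0"
    using \<open>Re l = 0\<close> assms by (auto simp: complex_eq_iff)
  ultimately show "l = \<i> * w \<or> l = - \<i> * w"
    by (auto simp: eq_neg_iff_add_eq_0)
qed

section \<open>The branch of the critical pair, parametrized by \<open>\<eta>\<close>\<close>

text \<open>The two final equations match the coefficients of the characteristic polynomial at
  \<open>\<eta> = x\<close> with those in \<open>root_of_factored_cubic\<close> for
  \<open>\<alpha> = \<sigma> + 2\<close>.\<close>

lemma critical_pair_branch:
  fixes \<sigma> b :: real
  assumes "b > 0" "\<sigma> > 0" and D: "\<sigma> - 2 - b * \<sigma> > 0"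
  defines "\<eta>0 \<equiv> (\<sigma> + 2) * (\<sigma> + 1) / (\<sigma> - 2 - b * \<sigma>)"
  obtains V u v d where "open V" "\<eta>0 \<in> V" "\<And>x. x \<in> V \<Longrightarrow> x > 0"
    "continuous_on V u" "continuous_on V v" "u \<eta>0 = 0" "v \<eta>0 > 0"
    "(u has_real_derivative d) (at \<eta>0)" "d \<noteq> 0"
    "\<And>x. x \<in> V \<Longrightarrow> \<sigma> + 1 + (1 + b) * x = (u x)\<^sup>2 + (v x)\<^sup>2 - 2 * u x * (\<sigma> + 2 + 2 * u x)"
    "\<And>x. x \<in> V \<Longrightarrow> 2 * (\<sigma> + b) * x = ((u x)\<^sup>2 + (v x)\<^sup>2) * (\<sigma> + 2 + 2 * u x)"
proof -
  \<comment> \<open>The linear coefficient gives \<open>u^2 + v^2 = q u + (1 + b) * \<eta>\<close>.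
    Inserting this into the constant coefficient gives \<open>\<eta> * m u = n u\<close>.\<close>
  define q where "q t = \<sigma> + 1 + 2 * t * (\<sigma> + 2) + 4 * t^2" for t
  define n where "n t = q t * (\<sigma> + 2 + 2 * t)" for t
  define m where "m t = \<sigma> - 2 - b * \<sigma> - 2 * (1 + b) * t" for t
  define f where "f t = n t / m t" for t
  \<comment> \<open>The first bound keeps \<open>\<sigma> + 1 + 2 * t * (\<sigma> + 2)\<close>
    positive and is itself below \<open>1 / 2\<close>; the second is the zero of
    \<open>m\<close>.\<close>
  define \<delta> where "\<delta> = min ((\<sigma> + 1) / (2 * (\<sigma> + 2))) ((\<sigma> - 2 - b * \<sigma>) / (2 * (1 + b)))"
  define S where "S = {-\<delta><..<\<delta>}"
  define g where "g = inv_into S f"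
  \<comment> \<open>This is the formula for \<open>u^2 + v^2\<close> solved for \<open>v\<close>
    with \<open>u = g x\<close>; subtracting \<open>u^2\<close> turns the \<open>4\<close> of
    \<open>q\<close> into \<open>3\<close>.\<close>
  define v where "v x = sqrt (\<sigma> + 1 + (1 + b) * x + 2 * g x * (\<sigma> + 2) + 3 * (g x)^2)" for x
  have "\<delta> > 0" using assms by (simp add: \<delta>_def)
  then have S: "open S" "0 \<in> S" by (simp_all add: S_def)
  have lin: "\<sigma> + 1 + 2 * t * (\<sigma> + 2) > 0" and m: "m t > 0" and t: "t > - 1 / 2" if "t \<in> S" for t
  proof -
    have "- t < (\<sigma> + 1) / (2 * (\<sigma> + 2))" "t < (\<sigma> - 2 - b * \<sigma>) / (2 * (1 + b))"
      using that by (auto simp: S_def \<delta>_def)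
    then show "\<sigma> + 1 + 2 * t * (\<sigma> + 2) > 0" "m t > 0"
      using assms by (simp_all add: m_def field_simps)
    have "(\<sigma> + 1) / (2 * (\<sigma> + 2)) < 1 / 2" using assms by (simp add: field_simps)
    then show "t > - 1 / 2" using \<open>- t < _\<close> by linarith
  qed
  have q: "q t > 0" if "t \<in> S" for t
    unfolding q_def using lin [OF that] by (rule add_pos_nonneg) simp
  have n: "n t > 0" if "t \<in> S" for t
    unfolding n_def using q [OF that] t [OF that] assms by simp
  have f: "f t > 0" if "t \<in> S" for t
    unfolding f_def using n m that by simp
  \<comment> \<open>On \<open>S\<close> the numerator is a product of positive increasing factors,
    while the positive denominator does not increase.\<close>
  have mono: "f s < f t" if "s \<in> S" "t \<in> S" "s < t" for s t
  proof -
    have "q t - q s = (t - s) * (2 * (\<sigma> + 2) + 4 * (s + t))"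
      by (simp add: q_def power2_eq_square algebra_simps)
    \<comment> \<open>Both points exceed \<open>- 1 / 2\<close>, so the second factor exceeds
      \<open>2 * \<sigma>\<close>.\<close>
    also have "\<dots> > 0"
      using that t [OF that(1)] t [OF that(2)] assms by (intro mult_pos_pos) auto
    finally have "n s < n t"
      unfolding n_def using that t [OF that(1)] q [OF that(1)] q [OF that(2)] assms
      by (intro mult_strict_mono) auto
    moreover have "m t \<le> m s" using that assms by (simp add: m_def mult_left_mono)
    ultimately show ?thesis
      unfolding f_def using n [OF that(1)] m [OF that(2)] by (intro frac_less) auto
  qed
  then have inj: "inj_on f S"
    by (intro linorder_inj_onI) fastforce+
  have cont: "continuous_on S f"
    unfolding f_def n_def q_def m_def
    by (intro continuous_intros) (use m in \<open>fastforce simp: m_def\<close>)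
  note inverse = continuous_inj_real_inverse [OF S(1) cont inj]
  have g: "g x \<in> S" "f (g x) = x" if "x \<in> f ` S" for x
    using that by (auto simp: g_def inv_into_into f_inv_into_f)
  have f0: "f 0 = \<eta>0"
    by (simp add: f_def n_def q_def m_def \<eta>0_def mult.commute)
  have g0: "g \<eta>0 = 0"
    unfolding f0 [symmetric] g_def using inj S by simp
  \<comment> \<open>The quotient rule for \<open>n / m\<close> at \<open>0\<close>; both summands
    are positive because \<open>m\<close> has slope \<open>- 2 * (1 + b)\<close>.\<close>
  define d where "d = ((2 * (\<sigma> + 2) * (\<sigma> + 2) + 2 * (\<sigma> + 1)) * (\<sigma> - 2 - b * \<sigma>)
      + 2 * (1 + b) * ((\<sigma> + 1) * (\<sigma> + 2))) / (\<sigma> - 2 - b * \<sigma>)^2"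
  have "d > 0"
    unfolding d_def using assms by (intro divide_pos_pos add_pos_pos mult_pos_pos) auto
  have "(f has_real_derivative d) (at 0)"
    unfolding f_def n_def q_def m_def d_def
    by (rule derivative_eq_intros refl | use D in \<open>simp add: power2_eq_square algebra_simps\<close>)+
  then have deriv: "(g has_real_derivative inverse d) (at \<eta>0)"
  proof (intro has_field_derivative_inverse_basic)
    show "\<eta>0 \<in> f ` S" using S f0 by blast
    with inverse show "continuous (at \<eta>0) g"
      unfolding g_def by (metis continuous_on_eq_continuous_at)
  qed (use \<open>d > 0\<close> g0 inverse g in auto)
  have v2: "(v x)^2 = \<sigma> + 1 + (1 + b) * x + 2 * g x * (\<sigma> + 2) + 3 * (g x)^2" and vpos: "v x > 0"
    if "x \<in> f ` S" for x
  proof -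
    have "x > 0" using that f by auto
    then have "\<sigma> + 1 + (1 + b) * x + 2 * g x * (\<sigma> + 2) + 3 * (g x)^2 > 0"
      using lin [OF g(1) [OF that]] assms
      by (smt (verit) mult_pos_pos zero_le_power2)
    then show "(v x)^2 = \<sigma> + 1 + (1 + b) * x + 2 * g x * (\<sigma> + 2) + 3 * (g x)^2" "v x > 0"
      by (simp_all add: v_def)
  qed
  show thesis
  proof (rule that)
    show "open (f ` S)" by (fact inverse)
    show "\<eta>0 \<in> f ` S" using S f0 by blast
    then show "v \<eta>0 > 0" by (rule vpos)
    show "continuous_on (f ` S) g" unfolding g_def by (fact inverse)
    then show "continuous_on (f ` S) v" unfolding v_def by (intro continuous_intros)
    show "(g has_real_derivative inverse d) (at \<eta>0)" "g \<eta>0 = 0" by fact+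
    show "inverse d \<noteq> 0" using \<open>d > 0\<close> by simp
    fix x assume x: "x \<in> f ` S"
    show "x > 0" using x f by auto
    show "\<sigma> + 1 + (1 + b) * x = (g x)\<^sup>2 + (v x)\<^sup>2 - 2 * g x * (\<sigma> + 2 + 2 * g x)"
      unfolding v2 [OF x] by (simp add: power2_eq_square algebra_simps)
    \<comment> \<open>Clearing the denominator in \<open>f (g x) = x\<close> recovers the constant
      coefficient equation.\<close>
    have "n (g x) = x * m (g x)"
      using g(2) [OF x] m [OF g(1) [OF x]] by (simp add: f_def field_simps)
    then show "2 * (\<sigma> + b) * x = ((g x)\<^sup>2 + (v x)\<^sup>2) * (\<sigma> + 2 + 2 * g x)"
      unfolding v2 [OF x] by (simp add: n_def m_def q_def power2_eq_square algebra_simps)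
  qed
qed

section \<open>The Hopf bifurcation\<close>

theorem theorem4p7:
  fixes A \<sigma> C Ra :: real
  assumes "A > 0" and "C > 0" and "\<sigma> > 0"
    and "L_fun A \<sigma> C > 0"
    and "Ra = Ra_Hopf A \<sigma> C"
  shows "hopf_bifurcation (vector_field A \<sigma> C) (E_plus A \<sigma> C) Ra"
proof -
  obtain k b where kb: "k > 0" "0 < b" and AC: "A = k^2 * b" "C = k * (\<sigma> - b)"
    using reparametrization [OF assms(1-3)] by metis
  note pos = kb assms(3)
  have "0 < 2 * \<sigma>^3 * k^3 * (\<sigma> - 2 - b * \<sigma>)"
    using assms(4) unfolding AC L_fun_reparametrized [OF pos] .
  then have D: "\<sigma> - 2 - b * \<sigma> > 0"
    by (rule zero_less_mult_pos) (use pos in simp)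
  define \<eta>0 where "\<eta>0 = (\<sigma> + 2) * (\<sigma> + 1) / (\<sigma> - 2 - b * \<sigma>)"
  have "Ra = \<sigma> * (\<sigma> + 4 - b) / (k * (\<sigma> - 2 - b * \<sigma>))"
    unfolding assms(5) Ra_Hopf_def AC L_fun_reparametrized [OF pos] R_fun_reparametrized [OF pos]
    using pos D by (simp add: divide_simps power2_eq_square power3_eq_cube power4_eq_xxxx)
  \<comment> \<open>The numerator \<open>\<sigma> * (\<sigma> + 4 - b) - (\<sigma> - 2 - b *
    \<sigma>)\<close> equals \<open>(\<sigma> + 2) * (\<sigma> + 1)\<close>.\<close>
  then have Ra: "k * Ra - 1 = \<eta>0"
    using pos D by (simp add: \<eta>0_def divide_simps) (simp add: algebra_simps)
  obtain V u v d where V: "open V" "\<eta>0 \<in> V" "\<And>x. x \<in> V \<Longrightarrow> x > 0"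
    and cont: "continuous_on V u" "continuous_on V v" and "u \<eta>0 = 0" "v \<eta>0 > 0"
    and d: "(u has_real_derivative d) (at \<eta>0)" "d \<noteq> 0"
    and coeff: "\<And>x. x \<in> V \<Longrightarrow>
        \<sigma> + 1 + (1 + b) * x = (u x)\<^sup>2 + (v x)\<^sup>2 - 2 * u x * (\<sigma> + 2 + 2 * u x)"
      "\<And>x. x \<in> V \<Longrightarrow> 2 * (\<sigma> + b) * x = ((u x)\<^sup>2 + (v x)\<^sup>2) * (\<sigma> + 2 + 2 * u x)"
    using critical_pair_branch [OF kb(2) assms(3) D] unfolding \<eta>0_def [symmetric] by metis
  \<comment> \<open>The neighbourhood of \<open>\<eta>0\<close> is pulled back along the affine map
    from \<open>r\<close> to \<open>\<eta>\<close>.\<close>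
  have "open ((\<lambda>r. k * r - 1) -` V)"
    by (intro continuous_open_vimage V continuous_intros)
  moreover have "Ra \<in> (\<lambda>r. k * r - 1) -` V" using V Ra by simp
  ultimately obtain \<epsilon> where "\<epsilon> > 0" and "ball Ra \<epsilon> \<subseteq> (\<lambda>r. k * r - 1) -` V"
    by (metis openE)
  then have inV: "k * r - 1 \<in> V" if "r \<in> {Ra - \<epsilon><..<Ra + \<epsilon>}" for r
    using that by (auto simp: ball_eq_greaterThanLessThan)
  define w where "w = v \<eta>0"
  have "w > 0" using \<open>v \<eta>0 > 0\<close> by (simp add: w_def)
  define ev where "ev r = Complex (u (k * r - 1)) (v (k * r - 1))" for r
  have char: "char_polynomial (linearization (vector_field A \<sigma> C) (E_plus A \<sigma> C) r) =
      map_poly complex_of_real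
        (let x = k * r - 1 in
          [:((u x)\<^sup>2 + (v x)\<^sup>2) * (\<sigma> + 2 + 2 * u x),
            (u x)\<^sup>2 + (v x)\<^sup>2 - 2 * u x * (\<sigma> + 2 + 2 * u x), \<sigma> + 2, 1:])"
    if "k * r - 1 \<in> V" for r
    unfolding AC Let_def char_polynomial_linearization [OF pos V(3) [OF that]] coeff [OF that] ..
  have char0: "char_polynomial (linearization (vector_field A \<sigma> C) (E_plus A \<sigma> C) Ra) =
      map_poly complex_of_real [:w\<^sup>2 * (\<sigma> + 2), w\<^sup>2, \<sigma> + 2, 1:]"
    using char [of Ra] V(2) by (simp add: Ra \<open>u \<eta>0 = 0\<close> w_def)
  have "\<sigma> + 2 > 0" using assms(3) by simp
  note pair = purely_imaginary_pair [OF this \<open>w > 0\<close>, folded char0]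
  show ?thesis
    unfolding hopf_bifurcation_def simple_eigenvalue_def
  proof (intro exI conjI ballI allI impI)
    show "\<epsilon> > 0" "w > 0" by fact+
    show "order (\<i> * complex_of_real w)
        (char_polynomial (linearization (vector_field A \<sigma> C) (E_plus A \<sigma> C) Ra)) = 1"
      "order (- \<i> * complex_of_real w)
        (char_polynomial (linearization (vector_field A \<sigma> C) (E_plus A \<sigma> C) Ra)) = 1"
      by (fact pair)+
    \<comment> \<open>A point that is not a root has order \<open>0\<close>, so order
      \<open>1\<close> already makes it an eigenvalue.\<close>
    then show "is_eigenvalue (linearization (vector_field A \<sigma> C) (E_plus A \<sigma> C) Ra) (\<i> * complex_of_real w)"
      "is_eigenvalue (linearization (vector_field A \<sigma> C) (E_plus A \<sigma> C) Ra) (- \<i> * complex_of_real w)"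
      unfolding is_eigenvalue_iff_root by (metis order_0I zero_neq_one)+
    fix l assume "is_eigenvalue (linearization (vector_field A \<sigma> C) (E_plus A \<sigma> C) Ra) l \<and> Re l = 0"
    then show "l = \<i> * complex_of_real w \<or> l = - \<i> * complex_of_real w"
      unfolding is_eigenvalue_iff_root using pair(3) by blast
  next
    fix r assume r: "r \<in> {Ra - \<epsilon><..<Ra + \<epsilon>}"
    show "vector_field A \<sigma> C r (E_plus A \<sigma> C r) = 0"
      unfolding AC by (rule E_plus_equilibrium [OF pos V(3) [OF inV [OF r]]])
    show "vector_field A \<sigma> C r differentiable at (E_plus A \<sigma> C r)"
      using vector_field_has_derivative by (rule differentiableI)
    show "is_eigenvalue (linearization (vector_field A \<sigma> C) (E_plus A \<sigma> C) r) (ev r)"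
      unfolding is_eigenvalue_iff_root char [OF inV [OF r]] Let_def ev_def
      by (rule root_of_factored_cubic)
  next
    show "ev Ra = \<i> * complex_of_real w"
      by (simp add: ev_def Ra \<open>u \<eta>0 = 0\<close> w_def complex_eq_iff)
    have "continuous_on {Ra - \<epsilon><..<Ra + \<epsilon>} (\<lambda>r. h (k * r - 1))" if "continuous_on V h" for h :: "real \<Rightarrow> real"
      using inV by (intro continuous_on_compose2 [OF that] continuous_intros) auto
    then show "continuous_on {Ra - \<epsilon><..<Ra + \<epsilon>} ev"
      unfolding ev_def using cont by (intro continuous_on_Complex) auto
    show "d * k \<noteq> 0" using d pos by simp
    \<comment> \<open>The change of parameter multiplies the speed \<open>d\<close> by
      \<open>k > 0\<close>, so it remains nonzero.\<close>
    have "((\<lambda>r. k * r - 1) has_real_derivative k) (at Ra)"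
      by (auto intro!: derivative_eq_intros)
    then show "((\<lambda>r. Re (ev r)) has_real_derivative d * k) (at Ra)"
      unfolding ev_def complex.sel using d(1) unfolding Ra [symmetric] by (rule DERIV_chain2 [rotated])
  qed
qed

end
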